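(* Let $\mathcal C$ and $\mathcal F$ be coarsenings and let $A, B \subseteq \omega$. Then: 1. $B \leq_{\mathrm T} A$ if and only if $\mathcal C(B) \leq_{\mathrm{nc}} \mathcal C(A)$. 2. If $\mathcal C$ is uniform, then $B \leq_{\mathrm T} A$ if and only if $\mathcal C(B) \leq_{\mathrm{uc}} \mathcal C(A)$. 3. $\mathcal C(A) \equiv_{\mathrm{nc}} \mathcal F(A)$. 4. If $\mathcal C$ and $\mathcal F$ are both uniform, then $\mathcal C(A) \equiv_{\mathrm{uc}} \mathcal F(A)$.
   Context: For $A \subseteq \omega$ and $n \geq 1$ let $\rho_n(A) = |A \cap [0,n)|/n$; the density $\rho(A)$ is $\lim_n \rho_n(A)$ when it exists. $D$ is a coarse description of $X$ if $\rho(D \triangle X) = 0$. $Y \leq_{\mathrm{uc}} X$ if there is a Turing functional $\Phi$ such that for every coarse description $D$ of $X$, $\Phi^D$ is a coarse description of $Y$. $Y \leq_{\mathrm{nc}} X$ if every coarse description of $X$ computes a coarse description of $Y$. The induced equivalence relations are $\equiv_{\mathrm{uc}}$ and $\equiv_{\mathrm{nc}}$. A map $\mathcal C : 2^\omega \to 2^\omega$ is a coarsening if for each $A$ we have $\mathcal C(A) \leq_{\mathrm T} A$, and for each coarse description $D$ of $\mathcal C(A)$ we have $A \leq_{\mathrm T} D$. A coarsening $\mathcal C$ is uniform if there is a binary Turing functional $\Gamma$ such that for every $A$ and every coarse description $D$ of $\mathcal C(A)$: (i) $\Gamma^D$ is total; and (ii) letting $A_s(n) = \Gamma^D(n,s)$,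 we have $A_s = A$ for cofinitely many $s$. *)

theory Defs
  imports Complex_Main
begin

text \<open>
  Turing functionals are the programs for partial recursive functions relative to an oracle:
  the basic functions and the characteristic function of the oracle, closed under
  composition, primitive recursion and unbounded minimization. A program does not depend on
  the oracle it is run with, and may be run on any number of arguments; an application to an
  unsuitable number of arguments diverges.
\<close>

datatype functional =
    Zero
  | Succ
  | Proj nat
  | Oracle
  | Comp functional "functional list"
  | PrimRec functional functional
  | Mu functional

text \<open>
  \<open>eval D \<Phi> xs\<close> is $\Phi^D(xs)$, with \<open>None\<close> for divergence. Minimization is the usual
  one: the search at \<open>n\<close> succeeds only if all earlier values converge and are nonzero.
\<close>

primrec eval :: "nat set \<Rightarrow> functional \<Rightarrow> nat list \<Rightarrow> nat option" where
  "eval D Zero xs = Some 0"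
| "eval D Succ xs = (case xs of [x] \<Rightarrow> Some (Suc x) | _ \<Rightarrow> None)"
| "eval D (Proj i) xs = (if i < length xs then Some (xs ! i) else None)"
| "eval D Oracle xs = (case xs of [x] \<Rightarrow> Some (of_bool (x \<in> D)) | _ \<Rightarrow> None)"
| "eval D (Comp f gs) xs = Option.bind (those (map (\<lambda>g. eval D g xs) gs)) (eval D f)"
| "eval D (PrimRec f g) xs =
     (case xs of [] \<Rightarrow> None
      | n # ys \<Rightarrow> rec_nat (eval D f ys) (\<lambda>k r. Option.bind r (\<lambda>y. eval D g (k # y # ys))) n)"
| "eval D (Mu f) xs =
     (let found = (\<lambda>n. eval D f (n # xs) = Some 0 \<and> (\<forall>m<n. \<exists>y>0. eval D f (m # xs) = Some y))
      in if \<exists>n. found n then Some (LEAST n. found n) else None)"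

text \<open>\<open>computes \<Phi> D E\<close>: $\Phi^D$ is total and is the characteristic function of \<open>E\<close>.\<close>

definition computes :: "functional \<Rightarrow> nat set \<Rightarrow> nat set \<Rightarrow> bool" where
  "computes \<Phi> D E \<longleftrightarrow> (\<forall>n. eval D \<Phi> [n] = Some (of_bool (n \<in> E)))"

definition turing_reducible :: "nat set \<Rightarrow> nat set \<Rightarrow> bool" (infix "\<le>\<^sub>T" 50) where
  "Y \<le>\<^sub>T X \<longleftrightarrow> (\<exists>\<Phi>. computes \<Phi> X Y)"

definition partial_density :: "nat \<Rightarrow> nat set \<Rightarrow> real" where
  "partial_density n A = real (card (A \<inter> {0..<n})) / real n"

definition has_density :: "nat set \<Rightarrow> real \<Rightarrow> bool" where
  "has_density A d \<longleftrightarrow> (\<lambda>n. partial_density n A) \<longlonglongrightarrow> d"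

definition coarse_description :: "nat set \<Rightarrow> nat set \<Rightarrow> bool" where
  "coarse_description D X \<longleftrightarrow> has_density (sym_diff D X) 0"

definition uc_reducible :: "nat set \<Rightarrow> nat set \<Rightarrow> bool" (infix "\<le>\<^sub>u\<^sub>c" 50) where
  "Y \<le>\<^sub>u\<^sub>c X \<longleftrightarrow>
     (\<exists>\<Phi>. \<forall>D. coarse_description D X \<longrightarrow> (\<exists>E. computes \<Phi> D E \<and> coarse_description E Y))"

definition nc_reducible :: "nat set \<Rightarrow> nat set \<Rightarrow> bool" (infix "\<le>\<^sub>n\<^sub>c" 50) where
  "Y \<le>\<^sub>n\<^sub>c X \<longleftrightarrow>
     (\<forall>D. coarse_description D X \<longrightarrow> (\<exists>E. E \<le>\<^sub>T D \<and> coarse_description E Y))"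

definition uc_equivalent :: "nat set \<Rightarrow> nat set \<Rightarrow> bool" (infix "\<equiv>\<^sub>u\<^sub>c" 50) where
  "X \<equiv>\<^sub>u\<^sub>c Y \<longleftrightarrow> X \<le>\<^sub>u\<^sub>c Y \<and> Y \<le>\<^sub>u\<^sub>c X"

definition nc_equivalent :: "nat set \<Rightarrow> nat set \<Rightarrow> bool" (infix "\<equiv>\<^sub>n\<^sub>c" 50) where
  "X \<equiv>\<^sub>n\<^sub>c Y \<longleftrightarrow> X \<le>\<^sub>n\<^sub>c Y \<and> Y \<le>\<^sub>n\<^sub>c X"

definition coarsening :: "(nat set \<Rightarrow> nat set) \<Rightarrow> bool" where
  "coarsening \<C> \<longleftrightarrow>
     (\<forall>A. \<C> A \<le>\<^sub>T A \<and> (\<forall>D. coarse_description D (\<C> A) \<longrightarrow> A \<le>\<^sub>T D))"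

text \<open>
  In the uniform case $\Gamma^D$ is only required to be total; the column
  $A_s = \Gamma^D(\cdot, s)$ has to be the characteristic function of \<open>A\<close> for cofinitely many
  \<open>s\<close>, and the finitely many other columns may take arbitrary values.
\<close>

definition uniform_coarsening :: "(nat set \<Rightarrow> nat set) \<Rightarrow> bool" where
  "uniform_coarsening \<C> \<longleftrightarrow> coarsening \<C> \<and>
     (\<exists>\<Gamma>. \<forall>A D. coarse_description D (\<C> A) \<longrightarrow>
        (\<forall>n s. eval D \<Gamma> [n, s] \<noteq> None) \<and>
        (\<forall>\<^sub>F s in cofinite. \<forall>n. eval D \<Gamma> [n, s] = Some (of_bool (n \<in> A))))"

end

theory Submission
  imports Defs
begin

text \<open>
  The nonuniform claims follow from transitivity of \<open>\<le>\<^sub>T\<close>. For the uniform ones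
  it suffices that $Y \leq_{\mathrm T} A$, say $Y = \Theta^A$, implies
  $Y \leq_{\mathrm{uc}} \mathcal C(A)$ for uniform $\mathcal C$. From a coarse description of
  $\mathcal C(A)$ one has columns $A_s$, almost all equal to $A$, but $\Theta^{A_s}$ may be
  partial for the exceptional $s$. So on input $n$ one searches for an $s \geq n$ such that
  $\Theta^{A_s}(n)$ converges within $s$ steps. The search ends because $A_s = A$ for all
  large $s$, and its outcome is $Y(n)$ as soon as $n$ exceeds all exceptional $s$.
\<close>

section \<open>Step-bounded evaluation\<close>

text \<open>
  Only minimization needs a bound: the search stops at \<open>t\<close>, or earlier at the first argument
  whose value is not seen to be positive.
\<close>

primrec bounded_eval :: "nat \<Rightarrow> nat set \<Rightarrow> functional \<Rightarrow> nat list \<Rightarrow> nat option" where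
  "bounded_eval t X Zero xs = Some 0"
| "bounded_eval t X Succ xs = (case xs of [x] \<Rightarrow> Some (Suc x) | _ \<Rightarrow> None)"
| "bounded_eval t X (Proj i) xs = (if i < length xs then Some (xs ! i) else None)"
| "bounded_eval t X Oracle xs = (case xs of [x] \<Rightarrow> Some (of_bool (x \<in> X)) | _ \<Rightarrow> None)"
| "bounded_eval t X (Comp f gs) xs =
     Option.bind (those (map (\<lambda>g. bounded_eval t X g xs) gs)) (bounded_eval t X f)"
| "bounded_eval t X (PrimRec f g) xs =
     (case xs of [] \<Rightarrow> None
      | n # ys \<Rightarrow> rec_nat (bounded_eval t X f ys)
          (\<lambda>k r. Option.bind r (\<lambda>y. bounded_eval t X g (k # y # ys))) n)"
| "bounded_eval t X (Mu f) xs =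
     (let n = (LEAST n. \<not> (n < t \<and> (\<exists>y>0. bounded_eval t X f (n # xs) = Some y)))
      in if bounded_eval t X f (n # xs) = Some 0 then Some n else None)"

lemma those_eq_Some_iff: "those zs = Some ys \<longleftrightarrow> zs = map Some ys"
  by (induction zs arbitrary: ys) (auto split: option.splits simp: Cons_eq_map_conv)

lemma map_eq_map_Some_mono:
  assumes "map f gs = map Some ys" and "\<And>g y. g \<in> set gs \<Longrightarrow> f g = Some y \<Longrightarrow> h g = Some y"
  shows "map h gs = map Some ys"
  using assms by (induction gs arbitrary: ys) (auto simp: Cons_eq_map_conv)

text \<open>Two distinct arguments cannot both be found: the smaller would have value 0 and also a
  positive value. Hence \<open>LEAST\<close> only names the unique witness.\<close>

lemma eval_Mu_eq_Some_iff:
  "eval X (Mu f) xs = Some n \<longleftrightarrow>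
    eval X f (n # xs) = Some 0 \<and> (\<forall>m<n. \<exists>y>0. eval X f (m # xs) = Some y)"
proof -
  define found where "found n \<longleftrightarrow> eval X f (n # xs) = Some 0 \<and>
    (\<forall>m<n. \<exists>y>0. eval X f (m # xs) = Some y)" for n
  have unique: "m = n" if "found m" "found n" for m n
    using that unfolding found_def by (metis linorder_neqE_nat option.inject less_irrefl)
  have eq: "eval X (Mu f) xs = (if \<exists>n. found n then Some (LEAST n. found n) else None)"
    by (simp add: found_def Let_def)
  have "eval X (Mu f) xs = Some n \<longleftrightarrow> found n"
    unfolding eq using unique by (auto intro: LeastI Least_equality)
  then show ?thesis by (simp add: found_def)
qed

text \<open>Soundness: a bounded search reports \<open>Some n\<close> only after seeing 0 at
  \<open>n\<close> and positive values below it, and by induction whatever is seen is a true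
  value.\<close>

lemma eval_eq_Some_if_bounded_eval:
  "bounded_eval t X \<Phi> xs = Some y \<Longrightarrow> eval X \<Phi> xs = Some y"
proof (induction \<Phi> arbitrary: xs y)
  case (Comp f gs)
  then obtain ys where ys: "map (\<lambda>g. bounded_eval t X g xs) gs = map Some ys"
    and y: "bounded_eval t X f ys = Some y"
    by (auto simp: bind_eq_Some_conv those_eq_Some_iff)
  have "map (\<lambda>g. eval X g xs) gs = map Some ys"
    using ys by (rule map_eq_map_Some_mono) (rule Comp.IH(2))
  then show ?case
    using Comp.IH(1)[OF y] by (simp add: those_eq_Some_iff[THEN iffD2])
next
  case (PrimRec f g)
  then obtain n ys where xs: "xs = n # ys" by (cases xs) auto
  have "bounded_eval t X (PrimRec f g) (n # ys) = Some y \<Longrightarrow> eval X (PrimRec f g) (n # ys) = Some y"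
    by (induction n arbitrary: y) (auto simp: bind_eq_Some_conv intro: PrimRec.IH)
  then show ?case using PrimRec.prems xs by simp
next
  case (Mu f)
  let ?P = "\<lambda>n. n < t \<and> (\<exists>y>0. bounded_eval t X f (n # xs) = Some y)"
  from Mu.prems have y: "y = (LEAST n. \<not> ?P n)" and zero: "bounded_eval t X f (y # xs) = Some 0"
    by (auto simp: Let_def split: if_splits)
  have "?P m" if "m < y" for m
    using not_less_Least[of m "\<lambda>n. \<not> ?P n"] that unfolding y by blast
  then have "\<forall>m<y. \<exists>z>0. eval X f (m # xs) = Some z"
    using Mu.IH by blast
  then show ?case
    unfolding eval_Mu_eq_Some_iff using Mu.IH[OF zero] by blast
qed (auto split: list.splits if_splits)

text \<open>Completeness: a convergent computation rests on finitely many subcomputations, each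
  reproduced for all large \<open>t\<close>. The filter replaces an explicit maximum of their
  bounds.\<close>

lemma eventually_bounded_eval:
  "eval X \<Phi> xs = Some y \<Longrightarrow> \<forall>\<^sub>F t in sequentially. bounded_eval t X \<Phi> xs = Some y"
proof (induction \<Phi> arbitrary: xs y)
  case (Comp f gs)
  then obtain ys where ys: "map (\<lambda>g. eval X g xs) gs = map Some ys"
    and y: "eval X f ys = Some y"
    by (auto simp: bind_eq_Some_conv those_eq_Some_iff)
  have "\<forall>\<^sub>F t in sequentially. \<forall>g\<in>set gs. \<forall>y. eval X g xs = Some y \<longrightarrow> bounded_eval t X g xs = Some y"
  proof (intro eventually_ball_finite ballI)
    fix g assume g: "g \<in> set gs"
    show "\<forall>\<^sub>F t in sequentially. \<forall>y. eval X g xs = Some y \<longrightarrow> bounded_eval t X g xs = Some y"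
      using Comp.IH(2)[OF g, of xs] by (cases "eval X g xs") auto
  qed simp
  then show ?case
    using Comp.IH(1)[OF y]
  proof eventually_elim
    case (elim t)
    have "map (\<lambda>g. bounded_eval t X g xs) gs = map Some ys"
      using ys by (rule map_eq_map_Some_mono) (use elim(1) in blast)
    then show ?case
      using elim(2) by (simp add: those_eq_Some_iff[THEN iffD2])
  qed
next
  case (PrimRec f g)
  then obtain n ys where xs: "xs = n # ys" by (cases xs) auto
  have "eval X (PrimRec f g) (n # ys) = Some y \<Longrightarrow>
      \<forall>\<^sub>F t in sequentially. bounded_eval t X (PrimRec f g) (n # ys) = Some y"
  proof (induction n arbitrary: y)
    case 0
    then show ?case using PrimRec.IH(1) by simp
  next
    case (Suc n)
    then obtain r where r: "eval X (PrimRec f g) (n # ys) = Some r"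
      and y: "eval X g (n # r # ys) = Some y"
      by (auto simp: bind_eq_Some_conv)
    show ?case
      using Suc.IH[OF r] PrimRec.IH(2)[OF y] by eventually_elim simp
  qed
  then show ?case using PrimRec.prems xs by simp
next
  case (Mu f)
  from Mu.prems have zero: "eval X f (y # xs) = Some 0"
    and pos: "\<forall>m<y. \<exists>z>0. eval X f (m # xs) = Some z"
    unfolding eval_Mu_eq_Some_iff by auto
  have "\<forall>\<^sub>F t in sequentially. \<forall>m\<in>{..<y}. \<exists>z>0. bounded_eval t X f (m # xs) = Some z"
  proof (intro eventually_ball_finite ballI)
    fix m assume "m \<in> {..<y}"
    then obtain z where "z > 0" "eval X f (m # xs) = Some z" using pos by auto
    then show "\<forall>\<^sub>F t in sequentially. \<exists>z>0. bounded_eval t X f (m # xs) = Some z"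
      using Mu.IH by (fastforce elim: eventually_mono)
  qed simp
  then show ?case
    using Mu.IH[OF zero] eventually_ge_at_top[of y]
  proof eventually_elim
    case (elim t)
    \<comment> \<open>Once \<open>t \<ge> y\<close> the cutoff cannot stop the search before
      \<open>y\<close>; at \<open>y\<close> it does stop, since the value 0 is not positive.\<close>
    have "(LEAST n. \<not> (n < t \<and> (\<exists>z>0. bounded_eval t X f (n # xs) = Some z))) = y"
    proof (rule Least_equality)
      fix n assume "\<not> (n < t \<and> (\<exists>z>0. bounded_eval t X f (n # xs) = Some z))"
      then show "y \<le> n" using elim by (metis lessThan_iff less_le_trans not_le)
    qed (use elim in auto)
    then show ?case using elim(2) by (simp add: Let_def)
  qed
qed (auto split: list.splits if_splits)


section \<open>Functions computable uniformly in the oracle\<close>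

text \<open>One program serves all oracles in \<open>\<D>\<close>; this records uniformity. Later
  \<open>\<D>\<close> is the class of coarse descriptions of \<open>\<C> A\<close>, on which
  \<Gamma> is guaranteed to be total, or a singleton.\<close>

definition computable_on :: "nat set set \<Rightarrow> nat \<Rightarrow> (nat set \<Rightarrow> nat list \<Rightarrow> nat) \<Rightarrow> bool" where
  "computable_on \<D> k F \<longleftrightarrow>
     (\<exists>\<Phi>. \<forall>D\<in>\<D>. \<forall>xs. length xs = k \<longrightarrow> eval D \<Phi> xs = Some (F D xs))"

text \<open>Argument tuples for \<open>Comp\<close>; the length \<open>n\<close> has to fit the
  arity of the outer function.\<close>

definition computable_list_on ::
    "nat set set \<Rightarrow> nat \<Rightarrow> nat \<Rightarrow> (nat set \<Rightarrow> nat list \<Rightarrow> nat list) \<Rightarrow> bool" where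
  "computable_list_on \<D> k n L \<longleftrightarrow>
     (\<exists>gs. \<forall>D\<in>\<D>. \<forall>xs. length xs = k \<longrightarrow>
        length (L D xs) = n \<and> map (\<lambda>g. eval D g xs) gs = map Some (L D xs))"

lemma computable_on_cong:
  assumes "computable_on \<D> k F"
    and "\<And>D xs. D \<in> \<D> \<Longrightarrow> length xs = k \<Longrightarrow> F D xs = G D xs"
  shows "computable_on \<D> k G"
  using assms unfolding computable_on_def by metis

lemma computable_list_on_Nil: "computable_list_on \<D> k 0 (\<lambda>D xs. [])"
  unfolding computable_list_on_def by (rule exI[of _ "[]"]) simp

lemma computable_list_on_Cons:
  assumes "computable_on \<D> k F" and "computable_list_on \<D> k n L"
  shows "computable_list_on \<D> k (Suc n) (\<lambda>D xs. F D xs # L D xs)"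
proof -
  obtain f where "\<forall>D\<in>\<D>. \<forall>xs. length xs = k \<longrightarrow> eval D f xs = Some (F D xs)"
    using assms(1) unfolding computable_on_def by blast
  moreover obtain gs where "\<forall>D\<in>\<D>. \<forall>xs. length xs = k \<longrightarrow>
      length (L D xs) = n \<and> map (\<lambda>g. eval D g xs) gs = map Some (L D xs)"
    using assms(2) unfolding computable_list_on_def by blast
  ultimately show ?thesis
    unfolding computable_list_on_def by (intro exI[of _ "f # gs"]) simp
qed

lemma computable_list_on_map:
  assumes "\<And>g. g \<in> set gs \<Longrightarrow> computable_on \<D> k (F g)"
  shows "computable_list_on \<D> k (length gs) (\<lambda>D xs. map (\<lambda>g. F g D xs) gs)"
  using assms
  by (induction gs) (simp_all add: computable_list_on_Nil computable_list_on_Cons)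

lemma computable_list_on_drop: "k = j + n \<Longrightarrow> computable_list_on \<D> k n (\<lambda>D xs. drop j xs)"
  unfolding computable_list_on_def
  by (rule exI[of _ "map Proj [j..<k]"]) (auto intro!: nth_equalityI)

lemma computable_on_compose:
  assumes "computable_on \<D> n F" and "computable_list_on \<D> k n L"
  shows "computable_on \<D> k (\<lambda>D xs. F D (L D xs))"
proof -
  obtain f where "\<forall>D\<in>\<D>. \<forall>xs. length xs = n \<longrightarrow> eval D f xs = Some (F D xs)"
    using assms(1) unfolding computable_on_def by blast
  moreover obtain gs where "\<forall>D\<in>\<D>. \<forall>xs. length xs = k \<longrightarrow>
      length (L D xs) = n \<and> map (\<lambda>g. eval D g xs) gs = map Some (L D xs)"
    using assms(2) unfolding computable_list_on_def by blast
  ultimately show ?thesis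
    unfolding computable_on_def
    by (intro exI[of _ "Comp f gs"]) (simp add: those_eq_Some_iff[THEN iffD2])
qed

lemma computable_on_nth: "i < k \<Longrightarrow> computable_on \<D> k (\<lambda>D xs. xs ! i)"
  unfolding computable_on_def by (rule exI[of _ "Proj i"]) simp

lemma computable_on_zero: "computable_on \<D> k (\<lambda>D xs. 0)"
  unfolding computable_on_def by (rule exI[of _ Zero]) simp

lemma computable_on_Suc:
  assumes "computable_on \<D> k F"
  shows "computable_on \<D> k (\<lambda>D xs. Suc (F D xs))"
proof -
  have "computable_on \<D> 1 (\<lambda>D xs. Suc (xs ! 0))"
    unfolding computable_on_def by (rule exI[of _ Succ]) (auto simp: length_Suc_conv)
  then show ?thesis
    using computable_on_compose[where L = "\<lambda>D xs. [F D xs]"]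
      computable_list_on_Cons[OF assms computable_list_on_Nil] by fastforce
qed

text \<open>\<open>PrimRec\<close> with a composition built in: the recursion count and the
  parameters may themselves be computed from the input.\<close>

lemma computable_on_rec_nat:
  assumes F: "computable_on \<D> n F" and G: "computable_on \<D> (Suc (Suc n)) G"
    and N: "computable_on \<D> k N" and L: "computable_list_on \<D> k n L"
  shows "computable_on \<D> k
    (\<lambda>D xs. rec_nat (F D (L D xs)) (\<lambda>i r. G D (i # r # L D xs)) (N D xs))"
proof -
  obtain f where f: "\<forall>D\<in>\<D>. \<forall>xs. length xs = n \<longrightarrow> eval D f xs = Some (F D xs)"
    using F unfolding computable_on_def by blast
  obtain g where g: "\<forall>D\<in>\<D>. \<forall>xs. length xs = Suc (Suc n) \<longrightarrow> eval D g xs = Some (G D xs)"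
    using G unfolding computable_on_def by blast
  have "eval D (PrimRec f g) (m # ys) = Some (rec_nat (F D ys) (\<lambda>i r. G D (i # r # ys)) m)"
    if "D \<in> \<D>" "length ys = n" for D m ys
    using that f g by (induction m) auto
  then have "computable_on \<D> (Suc n)
      (\<lambda>D xs. rec_nat (F D (tl xs)) (\<lambda>i r. G D (i # r # tl xs)) (hd xs))"
    unfolding computable_on_def by (intro exI[of _ "PrimRec f g"]) (auto simp: length_Suc_conv)
  from computable_on_compose[OF this computable_list_on_Cons[OF N L]] show ?thesis by simp
qed

text \<open>Existence of a zero makes the search converge: the values before the least zero are
  nonzero, hence positive as \<open>Mu\<close> demands.\<close>

lemma computable_on_Least:
  assumes F: "computable_on \<D> (Suc k) F"
    and total: "\<And>D xs. D \<in> \<D> \<Longrightarrow> length xs = k \<Longrightarrow> \<exists>n. F D (n # xs) = 0"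
  shows "computable_on \<D> k (\<lambda>D xs. LEAST n. F D (n # xs) = 0)"
proof -
  obtain f where f: "\<forall>D\<in>\<D>. \<forall>xs. length xs = Suc k \<longrightarrow> eval D f xs = Some (F D xs)"
    using F unfolding computable_on_def by blast
  have "eval D (Mu f) xs = Some (LEAST n. F D (n # xs) = 0)"
    if "D \<in> \<D>" "length xs = k" for D xs
    unfolding eval_Mu_eq_Some_iff
    using f that LeastI_ex[OF total[OF that]] by (auto dest: not_less_Least)
  then show ?thesis unfolding computable_on_def by blast
qed

section \<open>Truncated arithmetic, tests and case distinction\<close>

lemma computable_on_pred:
  assumes "computable_on \<D> k F"
  shows "computable_on \<D> k (\<lambda>D xs. F D xs - 1)"
proof -
  \<comment> \<open>A recursion step that returns its counter yields the truncated
    predecessor.\<close>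
  have "rec_nat 0 (\<lambda>i r. i) n = n - 1" for n by (cases n) auto
  moreover have "computable_on \<D> (Suc (Suc 0)) (\<lambda>D xs. xs ! 0)" by (rule computable_on_nth) simp
  ultimately show ?thesis
    using computable_on_rec_nat[OF computable_on_zero _ assms computable_list_on_Nil]
    by fastforce
qed

lemma computable_on_diff:
  assumes F: "computable_on \<D> k F" and G: "computable_on \<D> k G"
  shows "computable_on \<D> k (\<lambda>D xs. F D xs - G D xs)"
proof -
  \<comment> \<open>Subtraction iterates the predecessor; the previous result \<open>r\<close> is
    \<open>xs ! 1\<close> in the step function.\<close>
  have "rec_nat m (\<lambda>i r. r - 1) n = m - n" for m n :: nat by (induction n) auto
  moreover have "computable_on \<D> (Suc (Suc (Suc 0))) (\<lambda>D xs. xs ! 1 - 1)"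
    by (intro computable_on_pred computable_on_nth) simp
  ultimately show ?thesis
    using computable_on_rec_nat[OF computable_on_nth[of 0] _ G
        computable_list_on_Cons[OF F computable_list_on_Nil]]
    by fastforce
qed

lemma computable_on_eq_0:
  assumes "computable_on \<D> k F"
  shows "computable_on \<D> k (\<lambda>D xs. of_bool (F D xs = 0))"
  by (rule computable_on_cong,
      rule computable_on_diff[OF computable_on_Suc[OF computable_on_zero] assms]) simp

lemma computable_on_neq_0:
  assumes "computable_on \<D> k F"
  shows "computable_on \<D> k (\<lambda>D xs. of_bool (F D xs \<noteq> 0))"
  by (rule computable_on_cong, rule computable_on_eq_0[OF computable_on_eq_0[OF assms]]) simp

lemma computable_on_If_0:
  assumes P: "computable_on \<D> k (\<lambda>D xs. of_bool (P D xs))" and F: "computable_on \<D> k F"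
  shows "computable_on \<D> k (\<lambda>D xs. if P D xs then F D xs else 0)"
proof -
  \<comment> \<open>The recursion has length 0 or 1. Its step discards counter and previous result
    and returns the parameter, at index 2.\<close>
  have "computable_on \<D> (Suc (Suc (Suc 0))) (\<lambda>D xs. xs ! 2)"
    by (rule computable_on_nth) simp
  from computable_on_rec_nat[OF computable_on_zero this P
      computable_list_on_Cons[OF F computable_list_on_Nil]]
  show ?thesis by (rule computable_on_cong) simp
qed

lemma computable_on_conj:
  assumes "computable_on \<D> k (\<lambda>D xs. of_bool (P D xs))"
    and "computable_on \<D> k (\<lambda>D xs. of_bool (Q D xs))"
  shows "computable_on \<D> k (\<lambda>D xs. of_bool (P D xs \<and> Q D xs))"
  by (rule computable_on_cong, rule computable_on_If_0[OF assms]) simp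

lemma computable_on_Ball:
  assumes "\<And>g. g \<in> set gs \<Longrightarrow> computable_on \<D> k (\<lambda>D xs. of_bool (P g D xs))"
  shows "computable_on \<D> k (\<lambda>D xs. of_bool (\<forall>g\<in>set gs. P g D xs))"
  using assms
proof (induction gs)
  case Nil
  then show ?case using computable_on_Suc[OF computable_on_zero] by simp
next
  case (Cons g gs)
  then show ?case by (simp add: computable_on_conj)
qed

lemmas computable_on_intros =
  computable_on_zero computable_on_nth computable_on_Suc computable_on_pred computable_on_diff
  computable_on_eq_0 computable_on_neq_0 computable_on_If_0 computable_on_conj
  computable_list_on_Nil computable_list_on_Cons computable_list_on_drop


section \<open>Simulating a computation with a varying oracle\<close>

text \<open>With divergence coded as 0, bounded evaluation becomes a total function on numbers, so a
  program can detect that a bounded run has failed.\<close>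

fun option_code :: "nat option \<Rightarrow> nat" where
  "option_code None = 0"
| "option_code (Some y) = Suc y"

lemma option_code_bind:
  "option_code (Option.bind r f) =
     (if option_code r \<noteq> 0 then option_code (f (option_code r - 1)) else 0)"
  by (cases r) auto

lemma option_code_bind_those:
  "option_code (Option.bind (those (map h gs)) f) =
     (if \<forall>g\<in>set gs. option_code (h g) \<noteq> 0
      then option_code (f (map (\<lambda>g. option_code (h g) - 1) gs)) else 0)"
proof (induction gs arbitrary: f)
  case (Cons g gs)
  then show ?case
    \<comment> \<open>The value of the first argument is absorbed into the continuation, which is
      why \<open>f\<close> is generalized.\<close>
    using Cons.IH[of "\<lambda>ys. f (the (h g) # ys)"]
    by (cases "h g"; cases "those (map h gs)") auto
qed simp

text \<open>The input lists the bound, the column index and then the arguments of \<Phi>. As \<Phi>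
  is fixed, induction on it builds the simulating program directly, with oracle queries answered by
  the program for the columns. The arity \<open>k\<close> varies because subprograms take other
  numbers of arguments.\<close>

lemma computable_on_bounded_eval:
  assumes A: "computable_on \<D> 2 (\<lambda>D xs. of_bool (xs ! 0 \<in> A D (xs ! 1)))"
  shows "computable_on \<D> (Suc (Suc k))
    (\<lambda>D xs. option_code (bounded_eval (xs ! 0) (A D (xs ! 1)) \<Phi> (drop 2 xs)))"
proof (induction \<Phi> arbitrary: k)
  case Zero
  show ?case by (simp add: computable_on_intros)
next
  case Succ
  show ?case
  proof (cases "k = 1")
    case True
    \<comment> \<open>One \<open>Suc\<close> is the function itself, the other belongs to
      \<open>option_code\<close>.\<close>
    have "computable_on \<D> (Suc (Suc k)) (\<lambda>D xs. Suc (Suc (xs ! 2)))"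
      using True by (intro computable_on_intros) simp
    then show ?thesis
      by (rule computable_on_cong) (auto simp: True length_Suc_conv)
  next
    case False
    show ?thesis
      by (rule computable_on_cong[OF computable_on_zero])
         (use False in \<open>auto simp: length_Suc_conv split: list.splits\<close>)
  qed
next
  case (Proj i)
  show ?case
  proof (cases "i < k")
    case True
    then have "computable_on \<D> (Suc (Suc k)) (\<lambda>D xs. Suc (xs ! (i + 2)))"
      by (intro computable_on_intros) simp
    then show ?thesis
      by (rule computable_on_cong) (use True in \<open>auto simp: add.commute\<close>)
  next
    case False
    show ?thesis
      by (rule computable_on_cong[OF computable_on_zero]) (use False in auto)
  qed
next
  case Oracle
  show ?case
  proof (cases "k = 1")
    case True
    \<comment> \<open>The queried number comes first and the column index second, as in
      \<open>A\<close>.\<close>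
    have "computable_list_on \<D> (Suc (Suc k)) (Suc (Suc 0)) (\<lambda>D xs. [xs ! 2, xs ! 1])"
      using True by (intro computable_on_intros) simp_all
    then have "computable_list_on \<D> (Suc (Suc k)) 2 (\<lambda>D xs. [xs ! 2, xs ! 1])"
      by (simp add: numeral_2_eq_2)
    from computable_on_Suc[OF computable_on_compose[OF A this]] show ?thesis
      by (rule computable_on_cong) (auto simp: True length_Suc_conv)
  next
    case False
    show ?thesis
      by (rule computable_on_cong[OF computable_on_zero])
         (use False in \<open>auto simp: length_Suc_conv split: list.splits\<close>)
  qed
next
  case (Comp f gs)
  let ?c = "\<lambda>g D xs. option_code (bounded_eval (xs ! 0) (A D (xs ! 1)) g (drop 2 xs))"
  \<comment> \<open>Bound and column index are passed on, followed by the decoded values. A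
    diverging argument decodes to a meaningless 0, which the case distinction below
    discards.\<close>
  have "computable_list_on \<D> (Suc (Suc k)) (Suc (Suc (length gs)))
      (\<lambda>D xs. xs ! 0 # xs ! 1 # map (\<lambda>g. ?c g D xs - 1) gs)"
    by (intro computable_on_intros computable_list_on_map Comp.IH(2)) simp_all
  from computable_on_compose[OF Comp.IH(1) this]
  have "computable_on \<D> (Suc (Suc k)) (\<lambda>D xs. if \<forall>g\<in>set gs. ?c g D xs \<noteq> 0
      then ?c f D (xs ! 0 # xs ! 1 # map (\<lambda>g. ?c g D xs - 1) gs) else 0)"
    by (intro computable_on_If_0 computable_on_Ball computable_on_neq_0 Comp.IH(2))
  then show ?case
    by (rule computable_on_cong) (auto simp: option_code_bind_those)
next
  case (PrimRec f g)
  show ?case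
  proof (cases k)
    case 0
    show ?thesis
      by (rule computable_on_cong[OF computable_on_zero]) (simp add: 0)
  next
    case (Suc j)
    let ?c = "\<lambda>h D xs. option_code (bounded_eval (xs ! 0) (A D (xs ! 1)) h (drop 2 xs))"
    \<comment> \<open>The step receives counter, coded previous result, bound, column index and
      remaining arguments; bound and index must move to the front and the result be decoded.\<close>
    have "computable_list_on \<D> (Suc (Suc (Suc (Suc j)))) (Suc (Suc (Suc (Suc j))))
        (\<lambda>D xs. xs ! 2 # xs ! 3 # xs ! 0 # (xs ! 1 - 1) # drop 4 xs)"
      by (intro computable_on_intros) simp_all
    from computable_on_compose[OF PrimRec.IH(2)[of "Suc (Suc j)"] this]
    have step: "computable_on \<D> (Suc (Suc (Suc (Suc j)))) (\<lambda>D xs. if xs ! 1 \<noteq> 0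
        then ?c g D (xs ! 2 # xs ! 3 # xs ! 0 # (xs ! 1 - 1) # drop 4 xs) else 0)"
      by (intro computable_on_intros) simp_all
    have params: "computable_list_on \<D> (Suc (Suc (Suc j))) (Suc (Suc j))
        (\<lambda>D xs. xs ! 0 # xs ! 1 # drop 3 xs)"
      by (intro computable_on_intros) simp_all
    have count: "computable_on \<D> (Suc (Suc (Suc j))) (\<lambda>D xs. xs ! 2)"
      by (intro computable_on_intros) simp
    have rec: "option_code (bounded_eval t X (PrimRec f g) (n # ys)) =
        rec_nat (option_code (bounded_eval t X f ys))
          (\<lambda>i r. if r \<noteq> 0 then option_code (bounded_eval t X g (i # (r - 1) # ys)) else 0) n"
      for t X n ys
      by (induction n) (simp_all add: option_code_bind del: One_nat_def)
    from computable_on_rec_nat[OF PrimRec.IH(1) step count params] show ?thesis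
      unfolding Suc
    proof (rule computable_on_cong, goal_cases)
      case (1 D xs)
      then obtain t u n ys where "xs = t # u # n # ys" by (auto simp: length_Suc_conv)
      then show ?case
        by (simp add: rec del: bounded_eval.simps cong: if_cong)
    qed
  qed
next
  case (Mu f)
  let ?c = "\<lambda>D xs. option_code (bounded_eval (xs ! 0) (A D (xs ! 1)) f (drop 2 xs))"
  \<comment> \<open>The candidate \<open>n\<close> stands in front of the input, where
    \<open>computable_on_Least\<close> puts it, and is moved behind bound and index.\<close>
  let ?b = "\<lambda>D xs. ?c D (xs ! 1 # xs ! 2 # xs ! 0 # drop 3 xs)"
  have c: "computable_on \<D> (Suc (Suc (Suc k))) ?b"
  proof -
    have "computable_list_on \<D> (Suc (Suc (Suc k))) (Suc (Suc (Suc k)))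
        (\<lambda>D xs. xs ! 1 # xs ! 2 # xs ! 0 # drop 3 xs)"
      by (intro computable_on_intros) simp_all
    from computable_on_compose[OF Mu.IH this] show ?thesis .
  qed
  \<comment> \<open>This is 1 while the bounded search goes on: \<open>n\<close> is below the bound
    and the value is seen to be positive. It is 0 at the bound at the latest, so the search is
    total.\<close>
  let ?F = "\<lambda>D xs. of_bool (xs ! 1 - xs ! 0 \<noteq> 0 \<and> ?b D xs - 1 \<noteq> 0) :: nat"
  have "computable_on \<D> (Suc (Suc (Suc k))) ?F"
    by (intro computable_on_intros c) simp_all
  then have least: "computable_on \<D> (Suc (Suc k)) (\<lambda>D xs. LEAST n. ?F D (n # xs) = 0)"
    by (rule computable_on_Least) (use less_irrefl in \<open>fastforce simp: length_Suc_conv\<close>)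
  have "computable_list_on \<D> (Suc (Suc k)) (Suc (Suc (Suc k)))
      (\<lambda>D xs. (LEAST n. ?F D (n # xs) = 0) # drop 0 xs)"
    by (intro computable_on_intros least) simp
  then have "computable_list_on \<D> (Suc (Suc k)) (Suc (Suc (Suc k)))
      (\<lambda>D xs. (LEAST n. ?F D (n # xs) = 0) # xs)"
    by simp
  note b = computable_on_compose[OF c this]
  \<comment> \<open>Success means code exactly 1. The test for a nonzero code is essential, since
    code 0 also has truncated predecessor 0.\<close>
  have "computable_on \<D> (Suc (Suc k)) (\<lambda>D xs.
      if ?b D ((LEAST n. ?F D (n # xs) = 0) # xs) \<noteq> 0 \<and>
         ?b D ((LEAST n. ?F D (n # xs) = 0) # xs) - 1 = 0
      then Suc (LEAST n. ?F D (n # xs) = 0) else 0)"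
    by (intro computable_on_If_0 computable_on_conj computable_on_neq_0 computable_on_eq_0
        computable_on_pred computable_on_Suc b least)
  then show ?case
  proof (rule computable_on_cong)
    fix D :: "nat set" and xs :: "nat list"
    assume "length xs = Suc (Suc k)"
    then obtain t u ys where xs: "xs = t # u # ys" by (auto simp: length_Suc_conv)
    have code_pos: "option_code r - 1 \<noteq> 0 \<longleftrightarrow> (\<exists>y>0. r = Some y)"
      and code_zero: "option_code r \<noteq> 0 \<and> option_code r - 1 = 0 \<longleftrightarrow> r = Some 0" for r
      by (cases r; auto)+
    have b_eq: "?b D (n # xs) = option_code (bounded_eval t (A D u) f (n # ys))" for n
      by (simp add: xs eval_nat_numeral)
    have F_eq: "?F D (n # xs) = 0 \<longleftrightarrow>
        \<not> (n < t \<and> (\<exists>y>0. bounded_eval t (A D u) f (n # ys) = Some y))" for n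
      unfolding b_eq code_pos by (simp add: xs not_less)
    have "bounded_eval (xs ! 0) (A D (xs ! 1)) (Mu f) (drop 2 xs) =
        bounded_eval t (A D u) (Mu f) ys"
      by (simp add: xs eval_nat_numeral)
    then show "(if ?b D ((LEAST n. ?F D (n # xs) = 0) # xs) \<noteq> 0 \<and>
          ?b D ((LEAST n. ?F D (n # xs) = 0) # xs) - 1 = 0
        then Suc (LEAST n. ?F D (n # xs) = 0) else 0) =
        option_code (bounded_eval (xs ! 0) (A D (xs ! 1)) (Mu f) (drop 2 xs))"
      unfolding F_eq unfolding b_eq code_zero by (simp add: Let_def)
  qed
qed

text \<open>Agreement is stated pointwise so that constant columns give \<open>E = Y\<close>, while
  eventually constant ones give agreement at almost all \<open>n\<close>.\<close>

lemma computes_from_varying_oracle: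
  assumes A: "computable_on \<D> 2 (\<lambda>D xs. of_bool (xs ! 0 \<in> A D (xs ! 1)))"
    and \<Theta>: "computes \<Theta> X Y"
    and ev: "\<And>D. D \<in> \<D> \<Longrightarrow> \<forall>\<^sub>F s in sequentially. A D s = X"
  shows "\<exists>\<Phi>. \<forall>D\<in>\<D>. \<exists>E. computes \<Phi> D E \<and>
    (\<forall>n. (\<forall>s\<ge>n. A D s = X) \<longrightarrow> (n \<in> E \<longleftrightarrow> n \<in> Y))"
proof -
  let ?r = "\<lambda>D s n. bounded_eval s (A D s) \<Theta> [n]"
  define c where "c D xs = option_code (?r D (xs ! 0) (xs ! 1))" for D xs
  \<comment> \<open>The number \<open>s\<close> is repeated because it is both step bound and column
    index.\<close>
  have "computable_list_on \<D> (Suc (Suc 0)) (Suc (Suc (Suc 0))) (\<lambda>D xs. [xs ! 0, xs ! 0, xs ! 1])"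
    by (intro computable_on_intros) simp_all
  from computable_on_compose[OF computable_on_bounded_eval[OF A] this]
  have c: "computable_on \<D> (Suc (Suc 0)) c"
    by (rule computable_on_cong) (simp add: c_def)
  \<comment> \<open>The outer \<open>of_bool\<close> negates, so that a zero marks a successful
    \<open>s\<close>: \<open>n \<le> s\<close> and the bounded run converges.\<close>
  let ?F = "\<lambda>D xs. of_bool (of_bool (xs ! 1 - xs ! 0 = 0 \<and> c D xs \<noteq> 0) = (0::nat)) :: nat"
  define N where "N D n = (LEAST s. ?F D [s, n] = 0)" for D n
  have total: "\<exists>s. ?F D [s, n] = 0" if "D \<in> \<D>" for D n
  proof -
    have "eval X \<Theta> [n] = Some (of_bool (n \<in> Y))"
      using \<Theta> unfolding computes_def by blast
    from eventually_conj[OF eventually_bounded_eval[OF this]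
        eventually_conj[OF ev[OF that] eventually_ge_at_top[of n]]]
    obtain s where "bounded_eval s X \<Theta> [n] = Some (of_bool (n \<in> Y))" "A D s = X" "n \<le> s"
      by (auto dest: eventually_happens)
    then have "?F D [s, n] = 0" by (simp add: c_def)
    then show ?thesis ..
  qed
  have N: "n \<le> N D n" "?r D (N D n) n \<noteq> None" if "D \<in> \<D>" for D n
    using LeastI_ex[OF total[OF that, of n], folded N_def]
    by (cases "?r D (N D n) n"; auto simp: c_def)+
  have "computable_on \<D> (Suc (Suc 0)) ?F"
    by (intro computable_on_intros c) simp_all
  from computable_on_Least[OF this]
  have "computable_on \<D> (Suc 0) (\<lambda>D xs. LEAST s. ?F D (s # xs) = 0)"
    using total by (fastforce simp: length_Suc_conv)
  then have "computable_on \<D> (Suc 0) (\<lambda>D xs. N D (xs ! 0))"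
    by (rule computable_on_cong) (auto simp: length_Suc_conv N_def)
  then have "computable_list_on \<D> (Suc 0) (Suc (Suc 0)) (\<lambda>D xs. [N D (xs ! 0), xs ! 0])"
    by (intro computable_on_intros) simp_all
  \<comment> \<open>A wrong column may produce any number; testing the decoded value against 0
    forces a characteristic function.\<close>
  from computable_on_neq_0[OF computable_on_pred[OF computable_on_compose[OF c this]]]
  obtain \<Phi> where \<Phi>: "\<And>D xs. D \<in> \<D> \<Longrightarrow> length xs = Suc 0 \<Longrightarrow>
      eval D \<Phi> xs = Some (of_bool (c D [N D (xs ! 0), xs ! 0] - 1 \<noteq> 0))"
    unfolding computable_on_def by blast
  show ?thesis
  proof (intro exI[of _ \<Phi>] ballI)
    fix D assume D: "D \<in> \<D>"
    let ?E = "{n. c D [N D n, n] - 1 \<noteq> 0}"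
    have "computes \<Phi> D ?E"
      unfolding computes_def using \<Phi>[OF D] by simp
    moreover have "n \<in> ?E \<longleftrightarrow> n \<in> Y" if "\<forall>s\<ge>n. A D s = X" for n
    proof -
      obtain y where y: "?r D (N D n) n = Some y" using N(2)[OF D] by blast
      moreover have "A D (N D n) = X" using that N(1)[OF D] by blast
      ultimately have "eval X \<Theta> [n] = Some y"
        by (auto intro: eval_eq_Some_if_bounded_eval)
      then have "y = of_bool (n \<in> Y)" using \<Theta> unfolding computes_def by simp
      then show ?thesis using y by (simp add: c_def)
    qed
    ultimately show "\<exists>E. computes \<Phi> D E \<and>
        (\<forall>n. (\<forall>s\<ge>n. A D s = X) \<longrightarrow> (n \<in> E \<longleftrightarrow> n \<in> Y))"
      by blast
  qed
qed


section \<open>Reducibilities\<close>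

text \<open>Composition of reductions is the simulation with every column equal to
  \<open>Y\<close>.\<close>

lemma turing_reducible_trans:
  assumes "Z \<le>\<^sub>T Y" and "Y \<le>\<^sub>T X"
  shows "Z \<le>\<^sub>T X"
proof -
  obtain \<Theta> \<Psi> where \<Theta>: "computes \<Theta> Y Z" and \<Psi>: "computes \<Psi> X Y"
    using assms unfolding turing_reducible_def by blast
  have "computable_on {X} (Suc 0) (\<lambda>D xs. of_bool (xs ! 0 \<in> Y))"
    using \<Psi> unfolding computable_on_def computes_def
    by (intro exI[of _ \<Psi>]) (auto simp: length_Suc_conv)
  moreover have "computable_list_on {X} 2 (Suc 0) (\<lambda>D xs. [xs ! 0])"
    by (intro computable_on_intros) simp
  ultimately have "computable_on {X} 2 (\<lambda>D xs. of_bool ([xs ! 0] ! 0 \<in> Y))"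
    by (rule computable_on_compose)
  then have "computable_on {X} 2 (\<lambda>D xs. of_bool (xs ! 0 \<in> (\<lambda>D s. Y) D (xs ! 1)))" by simp
  from computes_from_varying_oracle[OF this \<Theta>] obtain \<Phi> E where
    "computes \<Phi> X E" and "\<forall>n. n \<in> E \<longleftrightarrow> n \<in> Z"
    by auto
  moreover from this have "E = Z" by blast
  ultimately show ?thesis unfolding turing_reducible_def by blast
qed

section \<open>Finite modifications and coarse descriptions\<close>

lemma has_density_0_if_finite:
  assumes "finite S"
  shows "has_density S 0"
  unfolding has_density_def
proof (rule tendsto_sandwich[OF _ _ tendsto_const lim_const_over_n[of "real (card S)"]])
  show "\<forall>\<^sub>F n in sequentially. 0 \<le> partial_density n S"
    by (simp add: partial_density_def)
  show "\<forall>\<^sub>F n in sequentially. partial_density n S \<le> real (card S) / real n"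
    using assms by (intro always_eventually allI)
      (simp add: partial_density_def divide_right_mono card_mono)
qed

lemma coarse_description_if_eventually:
  assumes "\<forall>\<^sub>F n in sequentially. n \<in> D \<longleftrightarrow> n \<in> X"
  shows "coarse_description D X"
proof -
  have "{n. \<not> (n \<in> D \<longleftrightarrow> n \<in> X)} = sym_diff D X" by blast
  moreover have "finite {n. \<not> (n \<in> D \<longleftrightarrow> n \<in> X)}"
    using assms by (simp add: cofinite_eq_sequentially[symmetric] eventually_cofinite)
  ultimately show ?thesis
    unfolding coarse_description_def using has_density_0_if_finite by simp
qed

lemma coarse_description_refl: "coarse_description X X"
  by (rule coarse_description_if_eventually) simp

section \<open>Reductions between coarsenings\<close>

lemma nc_reducible_if_uc_reducible:
  "Y \<le>\<^sub>u\<^sub>c X \<Longrightarrow> Y \<le>\<^sub>n\<^sub>c X"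
  unfolding uc_reducible_def nc_reducible_def turing_reducible_def by blast

text \<open>Each coarse description of \<open>\<C> A\<close> computes \<open>A\<close>, hence
  \<open>Y\<close>, which describes itself.\<close>

lemma nc_reducible_coarsening:
  assumes "coarsening \<C>" and "Y \<le>\<^sub>T A"
  shows "Y \<le>\<^sub>n\<^sub>c \<C> A"
  using assms turing_reducible_trans coarse_description_refl
  unfolding coarsening_def nc_reducible_def by blast

text \<open>As a description of itself, \<open>\<C> A\<close> computes a description of
  \<open>\<F> B\<close>, which in turn computes \<open>B\<close>; and \<open>A\<close> computes
  \<open>\<C> A\<close>.\<close>

lemma turing_reducible_if_nc_reducible_coarsenings:
  assumes "coarsening \<C>" and "coarsening \<F>" and "\<F> B \<le>\<^sub>n\<^sub>c \<C> A"
  shows "B \<le>\<^sub>T A"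
proof -
  obtain E where "E \<le>\<^sub>T \<C> A" and "coarse_description E (\<F> B)"
    using assms(3) coarse_description_refl unfolding nc_reducible_def by blast
  then show ?thesis
    using assms(1,2) turing_reducible_trans unfolding coarsening_def by meson
qed

lemma uc_reducible_uniform_coarsening:
  assumes "uniform_coarsening \<C>" and "Y \<le>\<^sub>T A"
  shows "Y \<le>\<^sub>u\<^sub>c \<C> A"
proof -
  obtain \<Gamma> where \<Gamma>: "\<And>D. coarse_description D (\<C> A) \<Longrightarrow>
      (\<forall>n s. eval D \<Gamma> [n, s] \<noteq> None) \<and>
      (\<forall>\<^sub>F s in cofinite. \<forall>n. eval D \<Gamma> [n, s] = Some (of_bool (n \<in> A)))"
    using assms(1) unfolding uniform_coarsening_def by blast
  obtain \<Theta> where \<Theta>: "computes \<Theta> A Y"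
    using assms(2) unfolding turing_reducible_def by blast
  define \<D> where "\<D> = {D. coarse_description D (\<C> A)}"
  \<comment> \<open>Exceptional columns of \<Gamma> need not be 0/1-valued, so nonzero values count
    as membership. Totality on \<open>\<D>\<close> makes \<open>the\<close> meaningful
    there.\<close>
  define col where "col D s = {n. the (eval D \<Gamma> [n, s]) \<noteq> 0}" for D s
  have "computable_on \<D> 2 (\<lambda>D xs. the (eval D \<Gamma> xs))"
    unfolding computable_on_def
    by (rule exI[of _ \<Gamma>]) (use \<Gamma> in \<open>fastforce simp: \<D>_def length_Suc_conv eval_nat_numeral\<close>)
  from computable_on_neq_0[OF this]
  have computable: "computable_on \<D> 2 (\<lambda>D xs. of_bool (xs ! 0 \<in> col D (xs ! 1)))"
    by (rule computable_on_cong) (auto simp: col_def length_Suc_conv eval_nat_numeral)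
  have ev: "\<forall>\<^sub>F s in sequentially. col D s = A" if "D \<in> \<D>" for D
  proof -
    have "\<forall>\<^sub>F s in sequentially. \<forall>n. eval D \<Gamma> [n, s] = Some (of_bool (n \<in> A))"
      using \<Gamma> that by (simp add: \<D>_def cofinite_eq_sequentially)
    then show ?thesis by eventually_elim (simp add: col_def)
  qed
  obtain \<Phi> where \<Phi>: "\<And>D. D \<in> \<D> \<Longrightarrow>
      \<exists>E. computes \<Phi> D E \<and> (\<forall>n. (\<forall>s\<ge>n. col D s = A) \<longrightarrow> (n \<in> E \<longleftrightarrow> n \<in> Y))"
    using computes_from_varying_oracle[OF computable \<Theta> ev] by blast
  have "\<exists>E. computes \<Phi> D E \<and> coarse_description E Y" if D: "D \<in> \<D>" for D
  proof -
    obtain E where E: "computes \<Phi> D E" "\<forall>n. (\<forall>s\<ge>n. col D s = A) \<longrightarrow> (n \<in> E \<longleftrightarrow> n \<in> Y)"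
      using \<Phi>[OF D] by blast
    \<comment> \<open>Beyond the last exceptional column, the whole tail from \<open>n\<close> on
      equals \<open>A\<close>.\<close>
    have "\<forall>\<^sub>F n in sequentially. n \<in> E \<longleftrightarrow> n \<in> Y"
      using eventually_all_ge_at_top[OF ev[OF D]] by eventually_elim (use E(2) in blast)
    then show ?thesis using E(1) coarse_description_if_eventually by blast
  qed
  then show ?thesis unfolding uc_reducible_def \<D>_def by blast
qed

theorem proposition2p2:
  fixes \<C> \<F> :: "nat set \<Rightarrow> nat set" and A B :: "nat set"
  assumes "coarsening \<C>" and "coarsening \<F>"
  shows "(B \<le>\<^sub>T A \<longleftrightarrow> \<C> B \<le>\<^sub>n\<^sub>c \<C> A) \<and>
         (uniform_coarsening \<C> \<longrightarrow> (B \<le>\<^sub>T A \<longleftrightarrow> \<C> B \<le>\<^sub>u\<^sub>c \<C> A)) \<and>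
         \<C> A \<equiv>\<^sub>n\<^sub>c \<F> A \<and>
         (uniform_coarsening \<C> \<and> uniform_coarsening \<F> \<longrightarrow> \<C> A \<equiv>\<^sub>u\<^sub>c \<F> A)"
proof -
  have below: "\<C> X \<le>\<^sub>T X" "\<F> X \<le>\<^sub>T X" for X
    using assms unfolding coarsening_def by blast+
  have le: "\<C> B \<le>\<^sub>T A" if "B \<le>\<^sub>T A"
    using turing_reducible_trans[OF below(1) that] .
  have ge: "B \<le>\<^sub>T A" if "\<C> B \<le>\<^sub>n\<^sub>c \<C> A"
    using turing_reducible_if_nc_reducible_coarsenings[OF assms(1,1) that] .
  \<comment> \<open>Forward directions apply the reducibility lemmas to
    \<open>\<C> B \<le>\<^sub>T A\<close>; the uniform converse passes through
    \<open>\<le>\<^sub>n\<^sub>c\<close>. The equivalences use \<open>\<F> A \<le>\<^sub>T A\<close>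
    for one direction and \<open>\<C> A \<le>\<^sub>T A\<close> for the other.\<close>
  show ?thesis
    unfolding nc_equivalent_def uc_equivalent_def
    using le ge below nc_reducible_coarsening[OF assms(1)] nc_reducible_coarsening[OF assms(2)]
      uc_reducible_uniform_coarsening nc_reducible_if_uc_reducible by blast
qed

end
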